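(* Let $g(z)=z+\sum_{n=2}^\infty b_nz^n\in\mathcal{A}$ with $b_2,b_3$ non-zero real numbers, let $\alpha\ge0$ be real, and let $\phi(z)=1+B_1z+B_2z^2+\cdots$ be a function satisfying the standing assumptions on $\phi$. If $f(z)=z+\sum_{n=2}^\infty a_nz^n\in\mathcal{S}^{\alpha}_{\mathscr{L}_g}(\phi)$, then for any complex number $\mu$ $$|a_3-\mu a_2^2|\le\frac{B_1}{2(2\alpha+1)|b_3|}\max\left\{1;\ \left|\frac{2\mu(2\alpha+1)B_1b_3}{(1+\alpha)^2b_2^2}+\frac{(\alpha^2-4\alpha-1)B_1}{(1+\alpha)^2}-\frac{B_2}{B_1}\right|\right\}.$$
   Context: $\mathbb{U}=\{z\in\mathbb{C}:|z|<1\}$. $\mathcal{A}$ is the class of functions analytic in $\mathbb{U}$ of the form $z+\sum_{n=2}^\infty a_nz^n$. Standing assumptions on $\phi$: $\phi$ is analytic in $\mathbb{U}$ with positive real part, $\phi(0)=1$, $\phi'(0)>0$, and $\phi$ maps $\mathbb{U}$ onto a region starlike with respect to $1$ and symmetric with respect to the real axis. Subordination: for $F,G$ analytic in $\mathbb{U}$, $F\prec G$ means there is an analytic $w:\mathbb{U}\to\mathbb{U}$ with $|w(z)|\le|z|$ and $F(z)=G(w(z))$. For $f(z)=z+\sum_{n\ge2}a_nz^n$ and $g(z)=z+\sum_{n\ge2}b_nz^n$ in $\mathcal{A}$, put $\mathscr{L}_g(f(z)):=(f*g)(z)=z+\sum_{n\ge2}a_nb_nz^n$; primes on $\mathscr{L}_g(f(z))$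 denote derivatives with respect to $z$ of this function. Define $$\Psi_g(f)(z):=1+\frac{z\mathscr{L}_g'(f(z))}{\mathscr{L}_g(f(z))}+\frac{z\mathscr{L}_g''(f(z))}{\mathscr{L}_g'(f(z))}-\frac{(1-\alpha)z^2\mathscr{L}_g''(f(z))+z\mathscr{L}_g'(f(z))}{(1-\alpha)z\mathscr{L}_g'(f(z))+\alpha\mathscr{L}_g(f(z))}$$ (with the removable singularity at $z=0$ filled in, value $1$). The class $\mathcal{S}^{\alpha}_{\mathscr{L}_g}(\phi)$ consists of all $f\in\mathcal{A}$ such that $\Psi_g(f)$ is analytic in $\mathbb{U}$ and $\Psi_g(f)\prec\phi$. *)

theory Defs
  imports "HOL-Complex_Analysis.Complex_Analysis"
begin

abbreviation unit_disc :: "complex set" where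
  "unit_disc \<equiv> ball 0 1"

abbreviation taylor_coeff :: "(complex \<Rightarrow> complex) \<Rightarrow> nat \<Rightarrow> complex" where
  "taylor_coeff f n \<equiv> fps_nth (fps_expansion f 0) n"

text \<open>
  Functions on the unit disc are modelled as total functions on the complex numbers; their values
  outside the disc play no role.
\<close>

definition class_A :: "(complex \<Rightarrow> complex) set" where
  "class_A = {f. f holomorphic_on unit_disc \<and> taylor_coeff f 0 = 0 \<and> taylor_coeff f 1 = 1}"

definition subordinate :: "(complex \<Rightarrow> complex) \<Rightarrow> (complex \<Rightarrow> complex) \<Rightarrow> bool" where
  "subordinate F G \<longleftrightarrow>
     (\<exists>w. w holomorphic_on unit_disc \<and> w ` unit_disc \<subseteq> unit_disc \<and>
          (\<forall>z\<in>unit_disc. norm (w z) \<le> norm z) \<and> (\<forall>z\<in>unit_disc. F z = G (w z)))"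

text \<open>
  The standing assumptions on \<open>\<phi>\<close>. Univalence is not assumed. The library predicate
  \<^const>\<open>starlike\<close> leaves the centre existentially quantified, whereas here it is the point \<open>1\<close>.
\<close>

definition starlike_wrt :: "complex \<Rightarrow> complex set \<Rightarrow> bool" where
  "starlike_wrt c S \<longleftrightarrow> c \<in> S \<and> (\<forall>x\<in>S. closed_segment c x \<subseteq> S)"

definition admissible_phi :: "(complex \<Rightarrow> complex) \<Rightarrow> bool" where
  "admissible_phi \<phi> \<longleftrightarrow>
     \<phi> holomorphic_on unit_disc \<and>
     (\<forall>z\<in>unit_disc. Re (\<phi> z) > 0) \<and>
     \<phi> 0 = 1 \<and>
     deriv \<phi> 0 \<in> \<real> \<and> Re (deriv \<phi> 0) > 0 \<and>
     starlike_wrt 1 (\<phi> ` unit_disc) \<and>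
     cnj ` (\<phi> ` unit_disc) = \<phi> ` unit_disc"

text \<open>The Hadamard product \<open>f * g\<close>, as the sum of the series with coefficients \<open>a\<^sub>n b\<^sub>n\<close>.\<close>

definition conv_op :: "(complex \<Rightarrow> complex) \<Rightarrow> (complex \<Rightarrow> complex) \<Rightarrow> complex \<Rightarrow> complex" where
  "conv_op g f z = (\<Sum>n. taylor_coeff f n * taylor_coeff g n * z ^ n)"

definition Psi_quot ::
    "real \<Rightarrow> (complex \<Rightarrow> complex) \<Rightarrow> (complex \<Rightarrow> complex) \<Rightarrow> complex \<Rightarrow> complex" where
  "Psi_quot \<alpha> g f z =
     (let L = conv_op g f; L' = deriv L; L'' = deriv L' in
        1 + z * L' z / L z + z * L'' z / L' z
          - ((1 - of_real \<alpha>) * z\<^sup>2 * L'' z + z * L' z)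
            / ((1 - of_real \<alpha>) * z * L' z + of_real \<alpha> * L z))"

text \<open>
  \<^const>\<open>remove_sings\<close> replaces the value at a point by the limit there if it exists, which
  discards the value \<open>x / 0 = 0\<close> at removable singularities; the value at the origin is \<open>1\<close>, see
  \<open>Psi_at_0\<close> below. At a pole the function is unbounded nearby, so it is not holomorphic on any
  neighbourhood of that point, whatever value it has there.
\<close>

definition Psi ::
    "real \<Rightarrow> (complex \<Rightarrow> complex) \<Rightarrow> (complex \<Rightarrow> complex) \<Rightarrow> complex \<Rightarrow> complex" where
  "Psi \<alpha> g f = remove_sings (Psi_quot \<alpha> g f)"

definition class_S ::
    "real \<Rightarrow> (complex \<Rightarrow> complex) \<Rightarrow> (complex \<Rightarrow> complex) \<Rightarrow> (complex \<Rightarrow> complex) set" where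
  "class_S \<alpha> g \<phi> =
     {f \<in> class_A. Psi \<alpha> g f holomorphic_on unit_disc \<and> subordinate (Psi \<alpha> g f) \<phi>}"

lemma conv_op_has_fps_expansion:
  assumes "f \<in> class_A" "g \<in> class_A"
  shows "conv_op g f has_fps_expansion Abs_fps (\<lambda>n. taylor_coeff f n * taylor_coeff g n)"
proof -
  have summ: "summable (\<lambda>n. norm (taylor_coeff h n * (1/2) ^ n))" if "h \<in> class_A" for h
  proof -
    have "h holomorphic_on eball 0 1"
      using that by (simp add: class_A_def one_ereal_def)
    then have "fps_conv_radius (fps_expansion h 0) \<ge> 1"
      using conv_radius_fps_expansion by blast
    moreover have "ereal (norm (1/2 :: complex)) < 1"
      by (simp add: one_ereal_def)
    ultimately show ?thesis
      unfolding fps_conv_radius_def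
      by (intro abs_summable_in_conv_radius) (rule order.strict_trans2)
  qed
  define F where "F = Abs_fps (\<lambda>n. taylor_coeff f n * taylor_coeff g n)"
  have lim: "(\<lambda>n. norm (taylor_coeff f n * (1/2) ^ n)) \<longlonglongrightarrow> 0"
    by (rule summable_LIMSEQ_zero[OF summ[OF assms(1)]])
  have "summable (\<lambda>n. fps_nth F n * (1/4) ^ n)"
  proof (rule summable_comparison_test_ev[OF _ summ[OF assms(2)]])
    have "eventually (\<lambda>n. norm (taylor_coeff f n * (1/2) ^ n) < 1) sequentially"
      using lim by (rule order_tendstoD) simp
    then show "eventually (\<lambda>n. norm (fps_nth F n * (1/4) ^ n)
                 \<le> norm (taylor_coeff g n * (1/2) ^ n)) sequentially"
    proof eventually_elim
      case (elim n)
      have "(1/4 :: complex) ^ n = (1/2) ^ n * (1/2) ^ n"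
        by (simp flip: power_mult_distrib)
      then have "norm (fps_nth F n * (1/4) ^ n)
            = norm (taylor_coeff f n * (1/2) ^ n) * norm (taylor_coeff g n * (1/2) ^ n)"
        unfolding F_def fps_nth_Abs_fps norm_mult by (simp only: norm_mult mult_ac)
      also have "\<dots> \<le> norm (taylor_coeff g n * (1/2) ^ n)"
        using elim by (intro mult_left_le_one_le) auto
      finally show ?case .
    qed
  qed
  then have "fps_conv_radius F \<ge> ereal (norm (1/4 :: complex))"
    unfolding fps_conv_radius_def by (rule conv_radius_geI)
  then have "fps_conv_radius F > 0"
    by (rule order.strict_trans2[rotated]) (simp add: zero_ereal_def)
  moreover have "conv_op g f = eval_fps F"
    by (simp add: fun_eq_iff conv_op_def eval_fps_def F_def)
  ultimately show ?thesis
    using eval_fps_has_fps_expansion F_def by metis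
qed

lemma Psi_at_0:
  assumes "f \<in> class_A" "g \<in> class_A"
  shows "Psi \<alpha> g f 0 = 1"
proof -
  define L where "L = conv_op g f"
  define F where "F = Abs_fps (\<lambda>n. taylor_coeff f n * taylor_coeff g n)"
  have F: "L has_fps_expansion F"
    unfolding L_def F_def by (rule conv_op_has_fps_expansion[OF assms])
  have F01: "fps_nth F 0 = 0" "fps_nth F 1 = 1"
    using assms by (auto simp: F_def class_A_def)
  note F1 = has_fps_expansion_deriv[OF F]
  note F2 = has_fps_expansion_deriv[OF F1]
  have L0: "L 0 = 0" and L1: "deriv L 0 = 1"
    using has_fps_expansion_imp_0_eq_fps_nth_0[OF F]
      has_fps_expansion_imp_0_eq_fps_nth_0[OF F1] F01 by auto
  have c1: "deriv L \<midarrow>0\<rightarrow> 1"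
    using has_fps_expansion_imp_continuous[OF F1, of UNIV] L1 by (simp add: isCont_def)
  obtain c where c2: "deriv (deriv L) \<midarrow>0\<rightarrow> c"
    using has_fps_expansion_imp_continuous[OF F2, of UNIV] by (auto simp: isCont_def)
  have "L field_differentiable at 0"
    using has_fps_expansion_imp_analytic_0[OF F] analytic_on_imp_differentiable_at by blast
  then have "(L has_field_derivative 1) (at 0)"
    using L1 by (metis DERIV_deriv_iff_field_differentiable)
  then have c0: "(\<lambda>z. L z / z) \<midarrow>0\<rightarrow> 1"
    by (simp add: has_field_derivative_iff L0)
  have "((\<lambda>z. 1 + deriv L z / (L z / z) + z * deriv (deriv L) z / deriv L z
         - ((1 - of_real \<alpha>) * z * deriv (deriv L) z + deriv L z)
            / ((1 - of_real \<alpha>) * deriv L z + of_real \<alpha> * (L z / z)))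
       \<longlongrightarrow> 1 + 1 / 1 + 0 * c / 1
         - ((1 - of_real \<alpha>) * 0 * c + 1) / ((1 - of_real \<alpha>) * 1 + of_real \<alpha> * 1)) (at 0)"
    by (intro tendsto_intros c0 c1 c2) auto
  moreover have "1 + deriv L z / (L z / z) + z * deriv (deriv L) z / deriv L z
         - ((1 - of_real \<alpha>) * z * deriv (deriv L) z + deriv L z)
            / ((1 - of_real \<alpha>) * deriv L z + of_real \<alpha> * (L z / z)) = Psi_quot \<alpha> g f z"
    if "z \<noteq> 0" for z
  proof -
    have "((1 - of_real \<alpha>) * z * deriv (deriv L) z + deriv L z)
            / ((1 - of_real \<alpha>) * deriv L z + of_real \<alpha> * (L z / z))
        = (z * ((1 - of_real \<alpha>) * z * deriv (deriv L) z + deriv L z))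
            / (z * ((1 - of_real \<alpha>) * deriv L z + of_real \<alpha> * (L z / z)))"
      using that by simp
    also have "\<dots> = ((1 - of_real \<alpha>) * z\<^sup>2 * deriv (deriv L) z + z * deriv L z)
            / ((1 - of_real \<alpha>) * z * deriv L z + of_real \<alpha> * L z)"
      using that by (simp add: algebra_simps power2_eq_square)
    finally show ?thesis
      by (simp add: Psi_quot_def Let_def mult.commute flip: L_def)
  qed
  ultimately have "Psi_quot \<alpha> g f \<midarrow>0\<rightarrow> 1"
    by (subst (asm) tendsto_cong[where g = "Psi_quot \<alpha> g f"])
       (auto simp: eventually_at_filter)
  then show ?thesis
    unfolding Psi_def by (rule remove_sings_eqI)
qed

end

theory Submission
  imports Defs
begin

text \<open>
  Write \<open>A\<^sub>n = a\<^sub>n b\<^sub>n\<close> for the coefficients of \<open>L = f * g\<close>. The last quotient in \<open>\<Psi>\<close> is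
  \<open>z E' / E\<close> for \<open>E = (1 - \<alpha>) z L' + \<alpha> L\<close>, so \<open>\<Psi>\<close> combines three logarithmic derivatives,
  and expanding them gives
  \<open>\<Psi> = 1 + (1 + \<alpha>) A\<^sub>2 z + (2 (2 \<alpha> + 1) A\<^sub>3 + (\<alpha>\<^sup>2 - 4 \<alpha> - 1) A\<^sub>2\<^sup>2) z\<^sup>2 + \<dots>\<close>
  (\<open>Psi_taylor_coeffs\<close>). On the other hand \<open>\<Psi> = \<phi> \<circ> w\<close> for a Schwarz function
  \<open>w = p z + q z\<^sup>2 + \<dots>\<close>, whose first coefficients are \<open>B\<^sub>1 p\<close> and \<open>B\<^sub>1 q + B\<^sub>2 p\<^sup>2\<close>.
  Comparing and solving for \<open>a\<^sub>2\<close> and \<open>a\<^sub>3\<close> turns the functional into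
  \<open>a\<^sub>3 - \<mu> a\<^sub>2\<^sup>2 = B\<^sub>1 / (2 (2 \<alpha> + 1) b\<^sub>3) (q - \<nu> p\<^sup>2)\<close>,
  where \<open>\<nu>\<close> is exactly the expression inside the maximum.

  What remains is the sharp estimate \<open>\<bar>q - \<nu> p\<^sup>2\<bar> \<le> max 1 \<bar>\<nu>\<bar>\<close> for Schwarz functions
  (\<open>norm_taylor_coeff_2_minus_square_le\<close>). It follows from \<open>\<bar>q\<bar> \<le> 1 - \<bar>p\<bar>\<^sup>2\<close>, the
  Schwarz--Pick inequality at the origin for \<open>w z / z\<close>: the bound is then a convex
  combination of \<open>1\<close> and \<open>\<bar>\<nu>\<bar>\<close> with weight \<open>\<bar>p\<bar>\<^sup>2\<close>.
\<close>

section \<open>Coefficients of Schwarz functions\<close>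

lemma holomorphic_on_disc_has_fps_expansion:
  assumes "f holomorphic_on unit_disc"
  shows "f has_fps_expansion fps_expansion f 0"
  using has_fps_expansion_fps_expansion[OF _ _ assms] by simp

text \<open>
  The Moebius automorphism of the disc that moves \<open>f 0\<close> to the origin reduces this to the
  Schwarz lemma; its derivative at \<open>c = f 0\<close> is \<open>1 / (1 - \<bar>c\<bar>\<^sup>2)\<close>.
\<close>

lemma norm_taylor_coeff_1_le_Schwarz_Pick:
  assumes holf: "f holomorphic_on unit_disc"
    and bound: "\<And>z. norm z < 1 \<Longrightarrow> norm (f z) < 1"
  shows "norm (taylor_coeff f 1) \<le> 1 - (norm (f 0))\<^sup>2"
proof -
  define c where "c = f 0"
  define M where "M = Moebius_function 0 c \<circ> f"
  have c1: "norm c < 1"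
    unfolding c_def using bound by simp
  have pos: "1 - (norm c)\<^sup>2 > 0"
    using c1 by (simp add: power_less_one_iff abs_square_less_1)
  have cc: "1 - cnj c * c = of_real (1 - (norm c)\<^sup>2)"
    by (simp only: complex_norm_square mult.commute of_real_diff of_real_1)
  have holM: "M holomorphic_on unit_disc"
    unfolding M_def
    by (rule holomorphic_on_compose_gen[OF holf Moebius_function_holomorphic[OF c1]])
       (use bound in auto)
  have "norm (deriv M 0) \<le> 1"
  proof (rule Schwarz_Lemma(2)[OF holM, of 0])
    show "M 0 = 0"
      by (simp add: M_def c_def Moebius_function_eq_zero)
    show "norm (M z) < 1" if "norm z < 1" for z
      using Moebius_function_norm_lt_1[OF c1 bound[OF that]] by (simp add: M_def)
  qed simp
  moreover have "deriv M 0 = deriv f 0 / of_real (1 - (norm c)\<^sup>2)"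
  proof (rule DERIV_imp_deriv)
    have df: "(f has_field_derivative deriv f 0) (at 0)"
      using holomorphic_derivI[OF holf] by simp
    have nz: "1 - cnj c * c \<noteq> 0"
      using pos unfolding cc of_real_eq_0_iff by linarith
    have "((\<lambda>z. (f z - c) / (1 - cnj c * f z)) has_field_derivative
            ((deriv f 0 - 0) * (1 - cnj c * f 0) - (f 0 - c) * (0 - (cnj c * deriv f 0)))
              / ((1 - cnj c * f 0) * (1 - cnj c * f 0))) (at 0)"
      by (rule derivative_eq_intros df refl | use nz in \<open>simp add: c_def\<close>)+
    moreover have "((deriv f 0 - 0) * (1 - cnj c * f 0) - (f 0 - c) * (0 - (cnj c * deriv f 0)))
              / ((1 - cnj c * f 0) * (1 - cnj c * f 0)) = deriv f 0 / of_real (1 - (norm c)\<^sup>2)"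
      using nz unfolding cc[symmetric] by (simp add: c_def)
    moreover have "M = (\<lambda>z. (f z - c) / (1 - cnj c * f z))"
      by (simp add: M_def fun_eq_iff Moebius_function_simple)
    ultimately show "(M has_field_derivative deriv f 0 / of_real (1 - (norm c)\<^sup>2)) (at 0)"
      by simp
  qed
  ultimately have "norm (deriv f 0) / (1 - (norm c)\<^sup>2) \<le> 1"
    using pos by (simp only: norm_divide norm_of_real abs_of_pos)
  then show ?thesis
    using pos by (simp add: fps_expansion_def c_def)
qed

text \<open>
  Dividing by \<open>z\<close> shifts the coefficients down by one, so this is the Schwarz--Pick inequality
  for the quotient \<open>h\<close> of \<open>w\<close> by \<open>z\<close>. That inequality needs \<open>\<bar>h\<bar> < 1\<close> strictly, which by the
  equality case of the Schwarz lemma fails only if \<open>w\<close> is a rotation; then the second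
  coefficient vanishes.
\<close>

lemma norm_taylor_coeff_2_le_Schwarz:
  assumes holw: "w holomorphic_on unit_disc" and w0: "w 0 = 0"
    and bound: "\<And>z. norm z < 1 \<Longrightarrow> norm (w z) < 1"
  shows "norm (taylor_coeff w 2) \<le> 1 - (norm (taylor_coeff w 1))\<^sup>2"
proof (cases "(\<exists>z. norm z < 1 \<and> z \<noteq> 0 \<and> norm (w z) = norm z) \<or> norm (deriv w 0) = 1")
  case True
  then obtain c where c: "\<And>z. norm z < 1 \<Longrightarrow> w z = c * z" "norm c = 1"
    using Schwarz_Lemma(3)[OF holw w0 bound, of 0] by auto
  have "(\<lambda>z. c * z) has_fps_expansion fps_const c * fps_X"
    by (intro fps_expansion_intros)
  moreover have "eventually (\<lambda>z. w z = c * z) (nhds 0)"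
    unfolding eventually_nhds
    using c by (intro exI[of _ unit_disc]) auto
  ultimately have "w has_fps_expansion fps_const c * fps_X"
    using has_fps_expansion_cong[OF _ refl] by metis
  then have "fps_expansion w 0 = fps_const c * fps_X"
    by (rule fps_expansion_eqI)
  then show ?thesis
    using c(2) by simp
next
  case False
  obtain h where h: "h holomorphic_on unit_disc"
      "\<And>z. norm z < 1 \<Longrightarrow> w z = z * h z" "deriv w 0 = h 0"
    using Schwarz3[OF holw w0] by blast
  have "norm (h z) < 1" if z: "norm z < 1" for z
  proof (cases "z = 0")
    case True
    have "norm (deriv w 0) \<le> 1"
      using Schwarz_Lemma(2)[OF holw w0 bound, of 0] by simp
    with False True h(3) show ?thesis
      by auto
  next
    case nz: False
    have "norm (w z) \<le> norm z"
      using Schwarz_Lemma(1)[OF holw w0 bound z] by simp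
    with False nz z have "norm (w z) < norm z"
      by (meson order_le_neq_trans)
    then show ?thesis
      using nz h(2)[OF z] by (simp add: norm_mult)
  qed
  note pick = norm_taylor_coeff_1_le_Schwarz_Pick[OF h(1) this]
  define H where "H = fps_expansion h 0"
  have H: "h has_fps_expansion H"
    unfolding H_def by (rule holomorphic_on_disc_has_fps_expansion[OF h(1)])
  have "(\<lambda>z. z * h z) has_fps_expansion fps_X * H"
    by (intro fps_expansion_intros H)
  moreover have "eventually (\<lambda>z. w z = z * h z) (nhds 0)"
    unfolding eventually_nhds
    using h(2) by (intro exI[of _ unit_disc]) auto
  ultimately have "w has_fps_expansion fps_X * H"
    using has_fps_expansion_cong[OF _ refl] by metis
  then have "fps_expansion w 0 = fps_X * H"
    by (rule fps_expansion_eqI)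
  moreover have "fps_nth H 0 = h 0"
    using has_fps_expansion_imp_0_eq_fps_nth_0[OF H] by simp
  ultimately show ?thesis
    using pick by (simp add: H_def)
qed

lemma norm_taylor_coeff_2_minus_square_le:
  assumes "w holomorphic_on unit_disc" "w 0 = 0" "\<And>z. norm z < 1 \<Longrightarrow> norm (w z) < 1"
  shows "norm (taylor_coeff w 2 - \<nu> * (taylor_coeff w 1)\<^sup>2) \<le> max 1 (norm \<nu>)"
proof -
  define t where "t = (norm (taylor_coeff w 1))\<^sup>2"
  have c2: "norm (taylor_coeff w 2) \<le> 1 - t"
    unfolding t_def by (rule norm_taylor_coeff_2_le_Schwarz[OF assms])
  then have t: "0 \<le> t" "t \<le> 1"
    using order.trans[OF norm_ge_zero c2] by (simp_all add: t_def)
  have "norm (taylor_coeff w 2 - \<nu> * (taylor_coeff w 1)\<^sup>2)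
          \<le> norm (taylor_coeff w 2) + norm \<nu> * t"
    by (rule norm_triangle_le_diff) (simp add: t_def norm_mult norm_power)
  also have "\<dots> \<le> (1 - t) * max 1 (norm \<nu>) + t * max 1 (norm \<nu>)"
  proof (rule add_mono)
    show "norm (taylor_coeff w 2) \<le> (1 - t) * max 1 (norm \<nu>)"
      using c2 t mult_left_mono[of 1 "max 1 (norm \<nu>)" "1 - t"] by simp
    show "norm \<nu> * t \<le> t * max 1 (norm \<nu>)"
      using t mult_left_mono[of "norm \<nu>" "max 1 (norm \<nu>)" t] by (simp add: mult.commute)
  qed
  also have "\<dots> = max 1 (norm \<nu>)"
    by (simp add: algebra_simps)
  finally show ?thesis .
qed

section \<open>Comparing coefficients\<close>

lemma subordinate_taylor_coeffs:
  assumes sub: "subordinate F \<phi>" and hol: "\<phi> holomorphic_on unit_disc"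
  obtains w where "w holomorphic_on unit_disc" "w 0 = 0" "\<And>z. norm z < 1 \<Longrightarrow> norm (w z) < 1"
    "taylor_coeff F 1 = taylor_coeff \<phi> 1 * taylor_coeff w 1"
    "taylor_coeff F 2 = taylor_coeff \<phi> 1 * taylor_coeff w 2
       + taylor_coeff \<phi> 2 * (taylor_coeff w 1)\<^sup>2"
proof -
  from sub obtain w where w: "w holomorphic_on unit_disc" "w ` unit_disc \<subseteq> unit_disc"
      "\<And>z. z \<in> unit_disc \<Longrightarrow> norm (w z) \<le> norm z" "\<And>z. z \<in> unit_disc \<Longrightarrow> F z = \<phi> (w z)"
    unfolding subordinate_def by blast
  have w0: "w 0 = 0"
    using w(3)[of 0] by simp
  define W where "W = fps_expansion w 0"
  have W: "w has_fps_expansion W"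
    unfolding W_def by (rule holomorphic_on_disc_has_fps_expansion[OF w(1)])
  have W0: "fps_nth W 0 = 0"
    using has_fps_expansion_imp_0_eq_fps_nth_0[OF W] w0 by simp
  have "(\<phi> \<circ> w) has_fps_expansion (fps_expansion \<phi> 0 oo W)"
    by (intro has_fps_expansion_compose holomorphic_on_disc_has_fps_expansion hol W W0)
  moreover have "eventually (\<lambda>z. F z = (\<phi> \<circ> w) z) (nhds 0)"
    unfolding eventually_nhds
    using w(4) by (intro exI[of _ unit_disc]) auto
  ultimately have "F has_fps_expansion (fps_expansion \<phi> 0 oo W)"
    using has_fps_expansion_cong[OF _ refl] by metis
  then have F: "fps_expansion F 0 = fps_expansion \<phi> 0 oo W"
    by (rule fps_expansion_eqI)
  show ?thesis
  proof
    show "w holomorphic_on unit_disc" "w 0 = 0"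
      by fact+
    show "norm (w z) < 1" if "norm z < 1" for z
      using w(2) that by (auto simp: image_subset_iff)
    show "taylor_coeff F 1 = taylor_coeff \<phi> 1 * taylor_coeff w 1"
      by (simp add: F fps_compose_nth W_def)
    show "taylor_coeff F 2 = taylor_coeff \<phi> 1 * taylor_coeff w 2
            + taylor_coeff \<phi> 2 * (taylor_coeff w 1)\<^sup>2"
      using W0 by (simp add: F fps_compose_nth W_def eval_nat_numeral fps_mult_nth)
  qed
qed

lemma fps_nth_divide_low:
  fixes F G :: "'a::field fps"
  assumes G0: "fps_nth G 0 = 1"
  shows "fps_nth (F / G) 0 = fps_nth F 0"
    and "fps_nth (F / G) 1 = fps_nth F 1 - fps_nth F 0 * fps_nth G 1"
    and "fps_nth (F / G) 2 = fps_nth F 2 - fps_nth F 0 * fps_nth G 2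
           - (fps_nth F 1 - fps_nth F 0 * fps_nth G 1) * fps_nth G 1"
proof -
  define Q where "Q = F / G"
  have "is_unit G"
    using G0 by (simp add: fps_is_unit_iff)
  then have F: "F = Q * G"
    unfolding Q_def by simp
  have "fps_nth F 0 = fps_nth Q 0"
    by (simp add: F G0)
  moreover have "fps_nth F 1 = fps_nth Q 1 + fps_nth Q 0 * fps_nth G 1"
    by (simp add: F G0 fps_mult_nth algebra_simps)
  moreover have "fps_nth F 2 = fps_nth Q 2 + fps_nth Q 1 * fps_nth G 1 + fps_nth Q 0 * fps_nth G 2"
    by (simp add: F G0 fps_mult_nth eval_nat_numeral algebra_simps)
  ultimately show "fps_nth (F / G) 0 = fps_nth F 0"
    "fps_nth (F / G) 1 = fps_nth F 1 - fps_nth F 0 * fps_nth G 1"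
    "fps_nth (F / G) 2 = fps_nth F 2 - fps_nth F 0 * fps_nth G 2
           - (fps_nth F 1 - fps_nth F 0 * fps_nth G 1) * fps_nth G 1"
    unfolding Q_def[symmetric] by (simp_all add: algebra_simps)
qed

text \<open>
  The hypothesis is on a punctured neighbourhood only: \<open>f\<close> may have a default value at \<open>0\<close>, and
  removing the singularity replaces it by \<open>h 0\<close>.
\<close>

lemma remove_sings_has_fps_expansion:
  fixes f h :: "complex \<Rightarrow> complex"
  assumes h: "h has_fps_expansion H" and eq: "eventually (\<lambda>z. f z = h z) (at 0)"
  shows "remove_sings f has_fps_expansion H"
proof -
  obtain S where S: "open S" "0 \<in> S" "\<And>z. z \<in> S \<Longrightarrow> z \<noteq> 0 \<Longrightarrow> f z = h z"
    using eq unfolding eventually_at_topological by blast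
  have "remove_sings f z = remove_sings h z" if z: "z \<in> S" for z
  proof (rule remove_sings_cong)
    \<comment> \<open>The origin is avoided as well: it is either the puncture \<open>z\<close> or away from \<open>z\<close>.\<close>
    have "eventually (\<lambda>u. u \<in> S - {0} - {z}) (at z)"
    proof (cases "z = 0")
      case True
      then show ?thesis
        using eventually_at_in_open[OF S(1) z] by simp
    next
      case False
      then show ?thesis
        using eventually_at_in_open[of "S - {0}" z] S(1) z by auto
    qed
    then show "eventually (\<lambda>u. f u = h u) (at z)"
      by eventually_elim (use S(3) in auto)
  qed simp
  then have "eventually (\<lambda>z. remove_sings f z = remove_sings h z) (nhds 0)"
    using S(1,2) unfolding eventually_nhds by blast
  moreover have "eventually (\<lambda>z. remove_sings h z = h z) (nhds 0)"
    by (rule eventually_remove_sings_eq_nhds[OF has_fps_expansion_imp_analytic_0[OF h]])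
  ultimately have "eventually (\<lambda>z. remove_sings f z = h z) (nhds 0)"
    by eventually_elim simp
  then show ?thesis
    using h has_fps_expansion_cong[OF _ refl] by metis
qed

text \<open>
  The quotients \<open>z L' / L\<close> and \<open>z E' / E\<close>, where \<open>E = (1 - \<alpha>) z L' + \<alpha> L\<close>, are \<open>0 / 0\<close>
  at the origin. With \<open>K = L / z\<close>, extended by
  \<open>K 0 = 1\<close>, the common factor \<open>z\<close> cancels, and every denominator becomes a power series with
  constant term \<open>1\<close>.
\<close>

lemma Psi_taylor_coeffs:
  assumes f: "f \<in> class_A" and g: "g \<in> class_A"
  defines "A2 \<equiv> taylor_coeff f 2 * taylor_coeff g 2"
    and "A3 \<equiv> taylor_coeff f 3 * taylor_coeff g 3"
  shows "taylor_coeff (Psi \<alpha> g f) 1 = (1 + of_real \<alpha>) * A2"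
    and "taylor_coeff (Psi \<alpha> g f) 2
           = 2 * (2 * of_real \<alpha> + 1) * A3 + (of_real \<alpha> ^ 2 - 4 * of_real \<alpha> - 1) * A2\<^sup>2"
proof -
  define L where "L = conv_op g f"
  define F where "F = Abs_fps (\<lambda>n. taylor_coeff f n * taylor_coeff g n)"
  define a where "a = complex_of_real \<alpha>"
  have F: "L has_fps_expansion F"
    unfolding L_def F_def by (rule conv_op_has_fps_expansion[OF f g])
  have nths: "fps_nth F 0 = 0" "fps_nth F (Suc 0) = 1" "fps_nth F 2 = A2" "fps_nth F 3 = A3"
    using f g by (auto simp: F_def class_A_def A2_def A3_def)
  define K where "K = (\<lambda>z. if z = 0 then 1 else L z / z ^ 1)"
  have K: "K has_fps_expansion fps_shift 1 F"
    unfolding K_def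
    by (rule has_fps_expansion_shift[OF F]) (use nths in \<open>auto intro!: subdegree_geI\<close>)
  \<comment> \<open>\<open>N = E'\<close> and \<open>D = E / z\<close>.\<close>
  define N where "N = (\<lambda>z. (1 - a) * (z * deriv (deriv L) z) + deriv L z)"
  define D where "D = (\<lambda>z. (1 - a) * deriv L z + a * K z)"
  define NF where "NF = fps_const (1 - a) * (fps_X * fps_deriv (fps_deriv F)) + fps_deriv F"
  define DF where "DF = fps_const (1 - a) * fps_deriv F + fps_const a * fps_shift 1 F"
  define G where "G = (\<lambda>z. 1 + deriv L z / K z + z * deriv (deriv L) z / deriv L z - N z / D z)"
  define GF where "GF = 1 + fps_deriv F / fps_shift 1 F
      + fps_X * fps_deriv (fps_deriv F) / fps_deriv F - NF / DF"
  have unit: "fps_nth (fps_shift 1 F) 0 = 1" "fps_nth (fps_deriv F) 0 = 1" "fps_nth DF 0 = 1"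
    using nths by (simp_all add: DF_def)
  have N: "N has_fps_expansion NF" and D: "D has_fps_expansion DF"
    unfolding N_def NF_def D_def DF_def by (intro fps_expansion_intros F K)+
  have G: "G has_fps_expansion GF"
    unfolding G_def GF_def by (intro fps_expansion_intros F K N D) (simp_all only: unit, simp_all)
  have "Psi_quot \<alpha> g f z = G z" if z: "z \<noteq> 0" for z
  proof -
    have "((1 - a) * z\<^sup>2 * deriv (deriv L) z + z * deriv L z)
            / ((1 - a) * z * deriv L z + a * L z) = (z * N z) / (z * D z)"
      using z by (simp add: N_def D_def K_def algebra_simps power2_eq_square)
    also have "\<dots> = N z / D z"
      using z by simp
    finally show ?thesis
      using z by (simp add: Psi_quot_def Let_def G_def K_def mult.commute flip: L_def a_def)
  qed
  then have "eventually (\<lambda>z. Psi_quot \<alpha> g f z = G z) (at 0)"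
    by (auto simp: eventually_at_filter)
  then have Psi: "fps_expansion (Psi \<alpha> g f) 0 = GF"
    unfolding Psi_def
    by (intro fps_expansion_eqI remove_sings_has_fps_expansion[OF G])
  have co: "fps_nth (fps_shift 1 F) 1 = A2" "fps_nth (fps_shift 1 F) 2 = A3"
    "fps_nth (fps_deriv F) 1 = 2 * A2" "fps_nth (fps_deriv F) 2 = 3 * A3"
    "fps_nth (fps_X * fps_deriv (fps_deriv F)) 0 = 0"
    "fps_nth (fps_X * fps_deriv (fps_deriv F)) 1 = 2 * A2"
    "fps_nth (fps_X * fps_deriv (fps_deriv F)) 2 = 6 * A3"
    using nths by (simp_all add: numeral_2_eq_2 numeral_3_eq_3)
  have coN: "fps_nth NF 0 = 1" "fps_nth NF 1 = (1 - a) * (2 * A2) + 2 * A2"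
    "fps_nth NF 2 = (1 - a) * (6 * A3) + 3 * A3"
    unfolding NF_def fps_add_nth fps_mult_left_const_nth co unit by simp_all
  have coD: "fps_nth DF 1 = (1 - a) * (2 * A2) + a * A2"
    "fps_nth DF 2 = (1 - a) * (3 * A3) + a * A3"
    unfolding DF_def fps_add_nth fps_mult_left_const_nth co by simp_all
  note div = fps_nth_divide_low[OF unit(1)] fps_nth_divide_low[OF unit(2)]
    fps_nth_divide_low[OF unit(3)]
  show "taylor_coeff (Psi \<alpha> g f) 1 = (1 + of_real \<alpha>) * A2"
    unfolding Psi GF_def fps_add_nth fps_sub_nth div co coN coD unit a_def[symmetric]
    by (simp add: algebra_simps)
  show "taylor_coeff (Psi \<alpha> g f) 2
           = 2 * (2 * of_real \<alpha> + 1) * A3 + (of_real \<alpha> ^ 2 - 4 * of_real \<alpha> - 1) * A2\<^sup>2"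
    unfolding Psi GF_def fps_add_nth fps_sub_nth div co coN coD unit a_def[symmetric]
    by (simp add: algebra_simps power2_eq_square)
qed

theorem theorem2p5:
  fixes f g \<phi> :: "complex \<Rightarrow> complex"
    and \<alpha> b2 b3 B1 :: real
    and a2 a3 B2 \<mu> :: complex
  assumes "g \<in> class_A"
    and "taylor_coeff g 2 = of_real b2" and "taylor_coeff g 3 = of_real b3"
    and "b2 \<noteq> 0" and "b3 \<noteq> 0"
    and "\<alpha> \<ge> 0"
    and "admissible_phi \<phi>"
    and "taylor_coeff \<phi> 1 = of_real B1" and "taylor_coeff \<phi> 2 = B2"
    and "f \<in> class_S \<alpha> g \<phi>"
    and "taylor_coeff f 2 = a2" and "taylor_coeff f 3 = a3"
  shows "norm (a3 - \<mu> * a2\<^sup>2) \<le>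
      B1 / (2 * (2 * \<alpha> + 1) * \<bar>b3\<bar>) *
      max 1 (norm (2 * \<mu> * (2 * of_real \<alpha> + 1) * of_real B1 * of_real b3
                     / ((1 + of_real \<alpha>)\<^sup>2 * (of_real b2)\<^sup>2)
                   + (of_real \<alpha> ^ 2 - 4 * of_real \<alpha> - 1) * of_real B1 / (1 + of_real \<alpha>)\<^sup>2
                   - B2 / of_real B1))"
proof -
  define a b c B where "a = complex_of_real \<alpha>" and "b = complex_of_real b2"
    and "c = complex_of_real b3" and "B = complex_of_real B1"
  define \<nu> where "\<nu> = 2 * \<mu> * (2 * a + 1) * B * c / ((1 + a)\<^sup>2 * b\<^sup>2)
    + (a ^ 2 - 4 * a - 1) * B / (1 + a)\<^sup>2 - B2 / B"
  have phi: "\<phi> holomorphic_on unit_disc" and "Re (deriv \<phi> 0) > 0"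
    using assms(7) by (auto simp: admissible_phi_def)
  then have B1: "B1 > 0"
    using assms(8) by (simp add: fps_expansion_def)
  have fA: "f \<in> class_A" and sub: "subordinate (Psi \<alpha> g f) \<phi>"
    using assms(10) by (auto simp: class_S_def)
  obtain w where w: "w holomorphic_on unit_disc" "w 0 = 0" "\<And>z. norm z < 1 \<Longrightarrow> norm (w z) < 1"
    and c1: "taylor_coeff (Psi \<alpha> g f) 1 = taylor_coeff \<phi> 1 * taylor_coeff w 1"
    and c2: "taylor_coeff (Psi \<alpha> g f) 2 = taylor_coeff \<phi> 1 * taylor_coeff w 2
       + taylor_coeff \<phi> 2 * (taylor_coeff w 1)\<^sup>2"
    using subordinate_taylor_coeffs[OF sub phi] by blast
  define p q where "p = taylor_coeff w 1" and "q = taylor_coeff w 2"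
  have e1: "(1 + a) * (a2 * b) = B * p"
    using c1 Psi_taylor_coeffs(1)[OF fA assms(1)] assms(2,8,11)
    by (simp add: a_def b_def B_def p_def)
  have e2: "2 * (2 * a + 1) * (a3 * c) + (a\<^sup>2 - 4 * a - 1) * (a2 * b)\<^sup>2 = B * q + B2 * p\<^sup>2"
    using c2 Psi_taylor_coeffs(2)[OF fA assms(1)] assms(2,3,8,9,11,12)
    by (simp add: a_def b_def c_def B_def p_def q_def)
  have "1 + a = of_real (1 + \<alpha>)" "2 * a + 1 = of_real (2 * \<alpha> + 1)"
    by (simp_all add: a_def)
  then have nz: "1 + a \<noteq> 0" "2 * a + 1 \<noteq> 0" "b \<noteq> 0" "c \<noteq> 0" "B \<noteq> 0"
    using assms(4-6) B1 by (auto simp: b_def c_def B_def simp del: of_real_add)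
  then have knz: "2 * (2 * a + 1) * c \<noteq> 0"
    by (simp only: mult_eq_0_iff) simp
  have a2: "a2 = B * p / ((1 + a) * b)"
    using e1 nz by (simp add: eq_divide_eq mult_ac)
  then have a2b: "a2 * b = B * p / (1 + a)"
    using nz by simp
  have "2 * (2 * a + 1) * c * a3
      = B * q + B2 * p\<^sup>2 - (a\<^sup>2 - 4 * a - 1) * (B * p / (1 + a))\<^sup>2"
    using e2 unfolding a2b by (simp add: algebra_simps)
  then have a3: "a3 = (B * q + B2 * p\<^sup>2 - (a\<^sup>2 - 4 * a - 1) * (B * p / (1 + a))\<^sup>2)
      / (2 * (2 * a + 1) * c)"
    using knz by (metis nonzero_mult_div_cancel_left)
  \<comment> \<open>The identity holds whatever the three polynomials in \<open>a\<close> are; only \<open>1 + a \<noteq> 0\<close> matters.\<close>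
  have "B * (2 * \<mu> * k * B * c / (s\<^sup>2 * b\<^sup>2) + t * B / s\<^sup>2 - B2 / B)
      = (2 * k * c) * (\<mu> * (B / (s * b))\<^sup>2) + t * (B / s)\<^sup>2 - B2" if "s \<noteq> 0" for k s t
    using that nz by (simp add: field_simps power2_eq_square)
  from this[OF nz(1)]
  have nu: "B * \<nu> = (2 * (2 * a + 1) * c) * (\<mu> * (B / ((1 + a) * b))\<^sup>2)
      + (a\<^sup>2 - 4 * a - 1) * (B / (1 + a))\<^sup>2 - B2"
    unfolding \<nu>_def .
  have sq: "(B * p / x)\<^sup>2 = (B / x)\<^sup>2 * p\<^sup>2" for x
    by (simp add: power_divide power_mult_distrib)
  have "(2 * (2 * a + 1) * c) * (a3 - \<mu> * a2\<^sup>2) = B * (q - \<nu> * p\<^sup>2)"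
  proof -
    have "(2 * (2 * a + 1) * c) * (a3 - \<mu> * a2\<^sup>2)
        = (B * q + B2 * p\<^sup>2 - (a\<^sup>2 - 4 * a - 1) * (B * p / (1 + a))\<^sup>2)
          - (2 * (2 * a + 1) * c) * (\<mu> * (B * p / ((1 + a) * b))\<^sup>2)"
      unfolding right_diff_distrib a2 by (simp only: a3 nonzero_mult_divide_mult_cancel_left
          nonzero_mult_div_cancel_left[OF knz] times_divide_eq_right knz)
    also have "\<dots> = B * q - (B * \<nu>) * p\<^sup>2"
      unfolding nu sq by (simp add: algebra_simps)
    finally show ?thesis
      by (simp add: algebra_simps)
  qed
  then have eq: "a3 - \<mu> * a2\<^sup>2 = B / (2 * (2 * a + 1) * c) * (q - \<nu> * p\<^sup>2)"
    using knz by (metis nonzero_mult_div_cancel_left times_divide_eq_left)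
  have "norm (a3 - \<mu> * a2\<^sup>2) = B1 / (2 * (2 * \<alpha> + 1) * \<bar>b3\<bar>) * norm (q - \<nu> * p\<^sup>2)"
  proof -
    have "B / (2 * (2 * a + 1) * c) = of_real (B1 / (2 * (2 * \<alpha> + 1) * b3))"
      by (simp add: a_def c_def B_def)
    then have "norm (B / (2 * (2 * a + 1) * c)) = \<bar>B1 / (2 * (2 * \<alpha> + 1) * b3)\<bar>"
      by (simp only: norm_of_real)
    also have "\<dots> = B1 / (2 * (2 * \<alpha> + 1) * \<bar>b3\<bar>)"
      using B1 assms(6) by (simp add: abs_mult)
    finally show ?thesis
      unfolding eq norm_mult by simp
  qed
  also have "\<dots> \<le> B1 / (2 * (2 * \<alpha> + 1) * \<bar>b3\<bar>) * max 1 (norm \<nu>)"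
    using norm_taylor_coeff_2_minus_square_le[OF w, of \<nu>] B1 assms(6)
    by (intro mult_left_mono) (simp_all add: p_def q_def)
  finally show ?thesis
    by (simp add: \<nu>_def a_def b_def c_def B_def)
qed

end
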